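(* Let $r\ge2$ be an integer. (1) For $x\in\mathbb C$ with $\operatorname{Im}(x)<0$, $$\mathcal C_r\left(\frac x{2}\right)=\exp\left(-\frac{(r-1)!}{(2\pi i)^{r-1}}\sum_{k=0}^{r-1}\frac{(\pi i)^k}{k!}\operatorname{Li}_{r-k}(-e^{-\pi ix})x^k+\frac{\pi i}{r}\left(\frac x2\right)^{r}-\frac{(r-1)!}{(2\pi i)^{r-1}}\zeta_E(r)\right).$$ (2) For $x\in\mathbb C$ with $\operatorname{Im}(x)>0$, $$\mathcal C_r\left(\frac x{2}\right)=\exp\left(-\frac{(r-1)!}{(-2\pi i)^{r-1}}\sum_{k=0}^{r-1}\frac{(-\pi i)^k}{k!}\operatorname{Li}_{r-k}(-e^{\pi ix})x^k-\frac{\pi i}{r}\left(\frac x2\right)^{r}-\frac{(r-1)!}{(-2\pi i)^{r-1}}\zeta_E(r)\right).$$ (3) If $r$ is even and $0\le x<1$ is real, then $$ \begin{aligned} \mathcal C_r\left(\frac x{2}\right)&=\left(2\cos\frac{\pi x}{2}\right)^{(\frac x2)^{r-1}} \exp\biggl((-1)^{\frac{r}{2}}\frac{(r-1)!}{(2\pi)^{r-1}}\sum_{\substack{1\leq k\leq r-3 \\ k\ \text{odd}}}\frac{(-1)^{\frac{k-1}2}(\pi x)^k}{k!}\sum_{n=1}^\infty \frac{(-1)^n\cos(\pi nx)}{n^{r-k}} \\ &\qquad-(-1)^{\frac{r}{2}}\frac{(r-1)!}{(2\pi)^{r-1}}\sum_{\substack{0\leq k\leq r-2 \\ k\ \text{even}}}\frac{(-1)^{\frac{k}2}(\pi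 x)^k}{k!}\sum_{n=1}^\infty \frac{(-1)^n\sin(\pi nx)}{n^{r-k}} \biggr). \end{aligned} $$ (4) If $r\ge3$ is odd and $0\le x<1$ is real, then $$ \begin{aligned} \mathcal C_r\left(\frac x{2}\right)&=\left(2\cos\frac{\pi x}{2}\right)^{(\frac x2)^{r-1}} \exp\biggl(-(-1)^{\frac{r-1}{2}}\frac{(r-1)!}{(2\pi)^{r-1}}\sum_{\substack{0\leq k\leq r-3 \\ k\ \text{even}}}\frac{(-1)^{\frac k2}(\pi x)^k}{k!}\sum_{n=1}^\infty \frac{(-1)^n\cos(\pi nx)}{n^{r-k}} \\ &\qquad-(-1)^{\frac{r-1}{2}}\frac{(r-1)!}{(2\pi)^{r-1}}\sum_{\substack{1\leq k\leq r-2 \\ k\ \text{odd}}}\frac{(-1)^{\frac{k-1}2}(\pi x)^k}{k!}\sum_{n=1}^\infty \frac{(-1)^n\sin(\pi nx)}{n^{r-k}} \\ &\qquad -(-1)^{\frac{r-1}2}\frac{(r-1)!}{(2\pi)^{r-1}}\zeta_E(r)\biggr). \end{aligned} $$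
   Context: For an integer $r\ge2$ let $P_r(y)=(1-y)\exp\left(y+\frac{y^2}{2}+\cdots+\frac{y^r}{r}\right)$. The multiple cosine function of Kurokawa–Koyama of order $r\ge2$ is $\mathcal C_r(x)=\prod_{n\ge1,\ n\text{ odd}}\left\{P_r\left(\frac{x}{n/2}\right)P_r\left(-\frac{x}{n/2}\right)^{(-1)^{r-1}}\right\}^{(n/2)^{r-1}}$, interpreted as $\mathcal C_r(x)=\exp\Big(\sum_{n\ge1,\,n\text{ odd}}(n/2)^{r-1}\big[\operatorname{Log}P_r(2x/n)+(-1)^{r-1}\operatorname{Log}P_r(-2x/n)\big]\Big)$, where $\operatorname{Log}P_r(y):=\operatorname{Log}(1-y)+y+\frac{y^2}{2}+\cdots+\frac{y^r}{r}$ with $\operatorname{Log}$ the principal branch. The series converges and defines a holomorphic function on $D=\mathbb C\setminus\big((-\infty,-\tfrac12]\cup[\tfrac12,\infty)\big)$ (which contains all non-real $x$), positive on $(-\tfrac12,\tfrac12)$. $\operatorname{Li}_k(z)=\sum_{n\ge1}z^n/n^k$ for $|z|<1$ is the polylogarithm, $\zeta_E(s)=\sum_{n=1}^\infty\frac{(-1)^{n+1}}{n^s}$. Empty sums are $0$. *)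

theory Defs
  imports "HOL-Analysis.Analysis"
begin

definition LogP :: "nat \<Rightarrow> complex \<Rightarrow> complex" where
  "LogP r y = Ln (1 - y) + (\<Sum>j=1..r. y ^ j / of_nat j)"

definition multicos :: "nat \<Rightarrow> complex \<Rightarrow> complex" where
  "multicos r x = exp (\<Sum>m. (of_nat (2*m+1) / 2) ^ (r - 1) *
      (LogP r (2 * x / of_nat (2*m+1)) + (-1) ^ (r - 1) * LogP r (- 2 * x / of_nat (2*m+1))))"

text \<open>Polylogarithm Li_k(z) = sum_{n>=1} z^n / n^k (used for |z| < 1).\<close>
definition polylog :: "nat \<Rightarrow> complex \<Rightarrow> complex" where
  "polylog k z = (\<Sum>n. z ^ (n+1) / of_nat (n+1) ^ k)"

definition zetaE :: "nat \<Rightarrow> real" where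
  "zetaE s = (\<Sum>n. (-1) ^ n / real (n+1) ^ s)"

end

theory Submission
  imports Defs
begin

text \<open>
  Termwise differentiation and the partial fraction expansion of the tangent show that the series
  \<open>F\<close> defining the logarithm of the multiple cosine satisfies
  \<open>F'(x) = - \<pi> x\<^bsup>r-1\<^esup> tan (\<pi> x)\<close> and \<open>F(0) = 0\<close>.
  In the lower half-plane the derivative of the polylogarithm sum telescopes to the same function
  (scaled by 1/2), so the two sides of (1) differ by a constant. Both extend continuously to the
  real interval \<open>(-1, 1)\<close>, where at \<open>x = 0\<close> the constant is seen to vanish because
  \<open>Li\<^sub>r(-1) = - \<zeta>\<^sub>E(r)\<close>.
  (2) follows from \<open>F(-x) = (-1)\<^bsup>r-1\<^esup> F(x)\<close>, and (3), (4) are the real part of the boundary version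
  of (1), since \<open>F\<close> is real there.
\<close>

section \<open>Partial fractions of the tangent, from the reflection formula of the Gamma
  function\<close>

text \<open>Shifting the reflection formula by 1/2 turns the sine into a cosine, whose logarithmic
  derivative is a tangent. On the other side stands
  \<open>Digamma (1/2 + x) - Digamma (1/2 - x)\<close>; in the difference of the two
  \<open>Digamma\<close> series the harmonic parts and the Euler constant cancel.\<close>

lemma tan_partial_fractions:
  fixes x :: complex
  assumes "cos (of_real pi * x) \<noteq> 0"
  shows "(\<lambda>m. 8 * x / (of_nat (2*m+1) ^ 2 - 4 * x ^ 2)) sums (of_real pi * tan (of_real pi * x))"
proof -
  \<comment> \<open>The poles of the two Gamma factors lie at half-integers, where the cosine
    vanishes.\<close>
  have nz: "1/2 + y \<notin> \<int>\<^sub>\<le>\<^sub>0" if y: "y = x \<or> y = -x" for y :: complex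
  proof
    assume "1/2 + y \<in> \<int>\<^sub>\<le>\<^sub>0"
    then obtain n where n: "1/2 + y = of_int n"
      by (auto elim!: nonpos_Ints_cases)
    have "cos (of_real pi * y) = cos (of_real pi * of_int n - of_real pi / 2)"
    proof -
      have "y = of_int n - 1/2" using n by (simp add: algebra_simps)
      then have "of_real pi * y = of_real pi * of_int n - of_real pi / 2"
        by (simp only: right_diff_distrib) simp
      then show ?thesis by (rule arg_cong)
    qed
    also have "\<dots> = sin (of_real (of_int n * pi))"
      by (simp add: cos_diff mult.commute)
    also have "\<dots> = 0"
      by (subst sin_of_real) (simp add: sin_zero_iff_int2)
    finally show False using y assms by auto
  qed
  have p: "1/2 + x \<notin> \<int>\<^sub>\<le>\<^sub>0" and q: "1/2 - x \<notin> \<int>\<^sub>\<le>\<^sub>0"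
    using nz[of x] nz[of "-x"] by auto
  have refl: "Gamma (1/2 + y) * Gamma (1/2 - y) = of_real pi / cos (of_real pi * y)" for y :: complex
  proof -
    have "sin (of_real pi * (1/2 + y)) = cos (of_real pi * y)"
      by (simp add: distrib_left sin_add)
    moreover have "1 - (1/2 + y) = 1/2 - y" by simp
    ultimately show ?thesis using Gamma_reflection_complex[of "1/2 + y"] by metis
  qed
  define g where "g = Gamma (1/2 + x) * Gamma (1/2 - x)"
  \<comment> \<open>Logarithmic derivative of the reflection formula.\<close>
  have "((\<lambda>y. Gamma (1/2 + y) * Gamma (1/2 - y)) has_field_derivative
          g * (Digamma (1/2 + x) - Digamma (1/2 - x))) (at x)"
    unfolding g_def using p q
    by (auto intro!: derivative_eq_intros simp: algebra_simps)
  moreover have "((\<lambda>y. Gamma (1/2 + y) * Gamma (1/2 - y)) has_field_derivative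
          g * (of_real pi * tan (of_real pi * x))) (at x)"
    unfolding g_def refl using assms
    by (auto intro!: derivative_eq_intros simp: tan_def divide_simps)
  ultimately have "g * (Digamma (1/2 + x) - Digamma (1/2 - x)) = g * (of_real pi * tan (of_real pi * x))"
    by (rule DERIV_unique)
  moreover have "g \<noteq> 0" unfolding g_def refl using assms by simp
  ultimately have D: "Digamma (1/2 + x) - Digamma (1/2 - x) = of_real pi * tan (of_real pi * x)"
    by simp
  have p0: "1/2 + x \<noteq> 0" and q0: "1/2 - x \<noteq> 0"
    using p q by (metis zero_in_nonpos_Ints)+
  have Dig: "(\<lambda>m. inverse (of_nat (Suc m)) - inverse (z + of_nat m)) sums (Digamma z + euler_mascheroni)"
    if "z \<noteq> 0" for z :: complex
    using summable_sums[OF summable_Digamma[OF that]] by (simp add: Polygamma_def)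
  have "(\<lambda>m. (inverse (of_nat (Suc m)) - inverse (1/2 + x + of_nat m))
           - (inverse (of_nat (Suc m)) - inverse (1/2 - x + of_nat m))) sums
        ((Digamma (1/2 + x) + euler_mascheroni) - (Digamma (1/2 - x) + euler_mascheroni))"
    by (intro sums_diff Dig p0 q0)
  moreover have "(inverse (of_nat (Suc m)) - inverse (1/2 + x + of_nat m))
           - (inverse (of_nat (Suc m)) - inverse (1/2 - x + of_nat m))
         = 8 * x / (of_nat (2*m+1) ^ 2 - 4 * x ^ 2)" for m
  proof -
    \<comment> \<open>\<open>A\<close> and \<open>B\<close> are twice the two shifted arguments, so
      \<open>A * B\<close> is the denominator sought and \<open>2 * (A - B)\<close> its
      numerator.\<close>
    define A B where "A = 2 * of_nat m + 1 + 2 * x" and "B = 2 * of_nat m + 1 - 2 * x"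
    have AB: "1/2 + x + of_nat m = A / 2" "1/2 - x + of_nat m = B / 2"
      by (simp_all add: A_def B_def field_simps)
    have "1/2 + x + of_nat m \<noteq> 0" "1/2 - x + of_nat m \<noteq> 0"
      using p q by (metis plus_of_nat_eq_0_imp)+
    then have nz: "A \<noteq> 0" "B \<noteq> 0" unfolding AB by auto
    have "8 * x = 2 * (A - B)" by (simp add: A_def B_def)
    moreover have "of_nat (2*m+1) ^ 2 - 4 * x ^ 2 = A * B"
      by (simp add: A_def B_def algebra_simps power2_eq_square)
    moreover have "2 / B - 2 / A = 2 * (A - B) / (A * B)"
      using nz by (simp add: divide_simps right_diff_distrib)
    ultimately show ?thesis unfolding AB by simp
  qed
  ultimately show ?thesis using D by simp
qed

section \<open>Termwise differentiation of the series in the exponent\<close>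

definition multicos_term :: "nat \<Rightarrow> nat \<Rightarrow> complex \<Rightarrow> complex" where
  "multicos_term r m x = (of_nat (2*m+1) / 2) ^ (r - 1) *
      (LogP r (2 * x / of_nat (2*m+1)) + (-1) ^ (r - 1) * LogP r (- 2 * x / of_nat (2*m+1)))"

text \<open>The polynomial part differentiates to the geometric sum (1 - y^r)/(1 - y), and its
  leading part cancels the derivative -1/(1 - y) of the logarithm.\<close>

lemma LogP_has_field_derivative:
  assumes "1 - y \<notin> \<real>\<^sub>\<le>\<^sub>0"
  shows "(LogP r has_field_derivative - (y ^ r / (1 - y))) (at y)"
proof -
  have y: "y \<noteq> 1" using assms by auto
  have pol: "((\<lambda>y::complex. \<Sum>j=1..r. y ^ j / of_nat j) has_field_derivative (\<Sum>j=1..r. y ^ (j - 1))) (at y)"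
    by (rule DERIV_sum) (auto intro!: derivative_eq_intros)
  have "(\<Sum>j=1..r. y ^ (j - 1)) = (\<Sum>j<r. y ^ j)"
    by (rule sum.reindex_bij_witness[of _ Suc "\<lambda>j. j - 1"]) auto
  also have "\<dots> = (1 - y ^ r) / (1 - y)"
    using y by (simp add: sum_gp_strict)
  finally have gp: "(\<Sum>j=1..r. y ^ (j - 1)) = (1 - y ^ r) / (1 - y)" .
  have "((\<lambda>y. Ln (1 - y)) has_field_derivative - (1 / (1 - y))) (at y)"
    using assms by (auto intro!: derivative_eq_intros simp: divide_simps)
  from DERIV_add[OF this pol] show ?thesis
    unfolding LogP_def gp by (simp add: diff_divide_distrib)
qed

text \<open>Meeting the branch cut of \<open>Ln\<close> would make x real with 2x at least n = 2m+1,
  hence x at least 1/2.\<close>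

lemma slit_plane_one_minus:
  assumes "Im x = 0 \<longrightarrow> \<bar>Re x\<bar> < 1/2"
  shows "1 - 2 * x / of_nat (2*m+1) \<notin> \<real>\<^sub>\<le>\<^sub>0"
proof
  assume A: "1 - 2 * x / of_nat (2*m+1) \<in> \<real>\<^sub>\<le>\<^sub>0"
  define n where "n = real (2*m+1)"
  have n: "n \<ge> 1" by (simp add: n_def)
  have e: "2 * x / of_nat (2*m+1) = (2 / n) *\<^sub>R x"
    by (simp add: n_def scaleR_conv_of_real)
  from A have "1 \<le> 2 / n * Re x" "Im x = 0"
    using n unfolding e complex_nonpos_Reals_iff by auto
  with n have "n \<le> 2 * Re x" by (simp add: field_simps)
  then show False using assms \<open>Im x = 0\<close> n by auto
qed

text \<open>With y = 2x/n, the sign (-1)^(r-1) makes both logarithms contribute with the same sign,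
  so that 1/(1 - y) + 1/(1 + y) combines to 2/(1 - y^2). The weight (n/2)^(r-1) then turns y^r back
  into x^r.\<close>

lemma multicos_term_has_field_derivative:
  assumes "Im x = 0 \<longrightarrow> \<bar>Re x\<bar> < 1/2" "r \<ge> 1"
  shows "(multicos_term r m has_field_derivative
           - (8 * x ^ r / (of_nat (2*m+1) ^ 2 - 4 * x ^ 2))) (at x)"
proof -
  define n :: complex where "n = of_nat (2*m+1)"
  have n: "n \<noteq> 0" unfolding n_def of_nat_eq_0_iff by simp
  define y where "y = 2 * x / n"
  have y1: "1 - y \<notin> \<real>\<^sub>\<le>\<^sub>0" and y2: "1 - (- y) \<notin> \<real>\<^sub>\<le>\<^sub>0"
    using slit_plane_one_minus[of x m] slit_plane_one_minus[of "-x" m] assms by (simp_all add: y_def n_def)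
  have ynz: "1 - y \<noteq> 0" "1 + y \<noteq> 0" using y1 y2 by auto
  have d1: "((\<lambda>x. LogP r (2 * x / n)) has_field_derivative - (y ^ r / (1 - y)) * (2 / n)) (at x)"
    unfolding y_def by (rule DERIV_chain2[OF LogP_has_field_derivative])
       (use y1 n in \<open>auto simp: y_def intro!: derivative_eq_intros\<close>)
  have d2: "((\<lambda>x. LogP r (- 2 * x / n)) has_field_derivative - ((- y) ^ r / (1 - (- y))) * (- 2 / n)) (at x)"
  proof -
    have "- y = - 2 * x / n" by (simp add: y_def)
    then show ?thesis using y2 n
      by (simp only:, intro DERIV_chain2[OF LogP_has_field_derivative])
        (auto intro!: derivative_eq_intros)
  qed
  have D: "(multicos_term r m has_field_derivative
          (n / 2) ^ (r - 1) * (- (y ^ r / (1 - y)) * (2 / n) + (-1) ^ (r - 1) *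
              (- ((- y) ^ r / (1 - (- y))) * (- 2 / n)))) (at x)"
    unfolding multicos_term_def n_def[symmetric]
    by (intro DERIV_cmult DERIV_add d1 d2)
  obtain s where s: "r = Suc s" using assms by (cases r) auto
  have x: "x = n * y / 2" using n by (simp add: y_def)
  \<comment> \<open>Here (-1)^(r-1) (-1)^r = -1, whatever the parity of r.\<close>
  have sgn: "(-1) ^ (r - 1) * (- ((- y) ^ r / (1 - (- y))) * (- 2 / n)) = - (y ^ r / (1 + y) * (2 / n))"
    unfolding power_minus[of y r] by (simp add: s flip: power_add mult_2)
  have 1: "- (y ^ r / (1 - y)) * (2 / n) + - (y ^ r / (1 + y) * (2 / n)) = - (4 * y ^ r / (n * ((1 - y) * (1 + y))))"
    using ynz n by (simp add: divide_simps) (simp add: algebra_simps)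
  have 2: "n ^ 2 - 4 * x ^ 2 = n ^ 2 * ((1 - y) * (1 + y))"
    by (simp add: x algebra_simps power2_eq_square)
  have 3: "x ^ r = (n / 2) ^ (r - 1) * (n / 2) * y ^ r"
    by (simp add: x s power_mult_distrib power_divide mult_ac)
  have 4: "c * - (4 * Y / (n * P)) = - (8 * (c * (n / 2) * Y) / (n ^ 2 * P))" for c Y P
    using n by (simp add: power2_eq_square)
  have "(n / 2) ^ (r - 1) * (- (y ^ r / (1 - y)) * (2 / n) + (-1) ^ (r - 1) *
              (- ((- y) ^ r / (1 - (- y))) * (- 2 / n))) = - (8 * x ^ r / (n ^ 2 - 4 * x ^ 2))"
    unfolding sgn 1 2 3 by (rule 4)
  with D show ?thesis by (simp add: n_def)
qed

text \<open>The open lower half-plane together with the real interval \<open>(-a, a)\<close>: it is convex, so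
  series can be differentiated termwise on it, and it lets the real case be read off as a boundary
  case of the lower half-plane.\<close>
definition slit_half_plane :: "real \<Rightarrow> complex set" where
  "slit_half_plane a = {x. Im x < 0 \<or> Im x = 0 \<and> \<bar>Re x\<bar> < a}"

text \<open>Between two real points this is convexity of an interval; otherwise a combination with
  positive weights has negative imaginary part.\<close>

lemma convex_slit_half_plane: "convex (slit_half_plane a)"
proof (rule convexI)
  fix x y :: complex and u v :: real
  assume A: "x \<in> slit_half_plane a" "y \<in> slit_half_plane a" "0 \<le> u" "0 \<le> v" "u + v = 1"
  show "u *\<^sub>R x + v *\<^sub>R y \<in> slit_half_plane a"
  proof (cases "u = 0 \<or> v = 0")
    case True then show ?thesis using A by auto
  next
    case False
    then have uv: "u > 0" "v > 0" using A by auto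
    show ?thesis
    proof (cases "Im x = 0 \<and> Im y = 0")
      case True
      then have "\<bar>Re x\<bar> < a" "\<bar>Re y\<bar> < a" using A by (auto simp: slit_half_plane_def)
      then have "u * \<bar>Re x\<bar> + v * \<bar>Re y\<bar> < u * a + v * a"
        using uv by (intro add_strict_mono) auto
      also have "\<dots> = a" using A by (simp flip: distrib_right)
      finally have "\<bar>u * Re x + v * Re y\<bar> < a"
        using abs_triangle_ineq[of "u * Re x" "v * Re y"] uv by (simp add: abs_mult)
      then show ?thesis using True by (simp add: slit_half_plane_def)
    next
      case False
      have "Im x \<le> 0" "Im y \<le> 0" using A by (auto simp: slit_half_plane_def)
      then have "u * Im x \<le> 0" "v * Im y \<le> 0" using uv by (auto simp: mult_le_0_iff)
      moreover have "u * Im x \<noteq> 0 \<or> v * Im y \<noteq> 0" using uv False by auto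
      ultimately have "u * Im x + v * Im y < 0" by linarith
      then show ?thesis by (simp add: slit_half_plane_def)
    qed
  qed
qed

text \<open>On a bounded set the M-test applies from the index on where n = 2m+1 is at least 4R:
  there |4x^2| is at most n^2/4, so the denominator is at least n^2/2 in modulus. Only an eventual
  bound is available, since the first denominators may be arbitrarily small.\<close>

lemma uniform_limit_multicos_term_deriv:
  assumes "S \<subseteq> ball 0 R"
  shows "uniform_limit S (\<lambda>N x. \<Sum>m<N. - (8 * x ^ r / (of_nat (2*m+1) ^ 2 - 4 * x ^ 2)))
           (\<lambda>x::complex. \<Sum>m. - (8 * x ^ r / (of_nat (2*m+1) ^ 2 - 4 * x ^ 2))) sequentially"
proof (rule Weierstrass_m_test_ev)
  show "summable (\<lambda>m. 16 * R ^ r * inverse (real (Suc m) ^ 2))"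
    by (intro summable_mult) (use inverse_power_summable[of 2, where ?'a=real] in
       \<open>subst summable_Suc_iff[of "\<lambda>n. inverse (real n ^ 2)"], simp\<close>)
  show "\<forall>\<^sub>F m in sequentially. \<forall>x\<in>S. norm (- (8 * x ^ r / (of_nat (2*m+1) ^ 2 - 4 * x ^ 2)))
           \<le> 16 * R ^ r * inverse (real (Suc m) ^ 2)"
  proof (intro eventually_sequentiallyI[of "nat \<lceil>4 * R\<rceil>"] ballI)
    fix m x assume m: "m \<ge> nat \<lceil>4 * R\<rceil>" and "x \<in> S"
    then have x: "norm x < R" using assms by auto
    then have R: "0 < R" by (meson norm_ge_zero le_less_trans)
    define n where "n = real (2*m+1)"
    have n: "4 * R \<le> n" "real (Suc m) \<le> n" "n > 0" using m R unfolding n_def by linarith+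
    have "norm (4 * x ^ 2) = 4 * norm x ^ 2" by (simp add: norm_mult norm_power)
    also have "\<dots> \<le> 4 * (n / 4) ^ 2" using x n by (intro mult_left_mono power_mono) auto
    finally have a: "norm (4 * x ^ 2) \<le> n ^ 2 / 4" by (simp add: power_divide)
    have "n ^ 2 - norm (4 * x ^ 2) \<le> norm (of_nat (2*m+1) ^ 2 - 4 * x ^ 2)"
      using norm_triangle_ineq2[of "of_nat (2*m+1) ^ 2" "4 * x ^ 2"] by (simp add: n_def norm_power del: of_nat_Suc of_nat_add)
    with a have b: "n ^ 2 / 2 \<le> norm (of_nat (2*m+1) ^ 2 - 4 * x ^ 2)"
      using zero_le_power2[of n] by linarith
    have "norm (- (8 * x ^ r / (of_nat (2*m+1) ^ 2 - 4 * x ^ 2)))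
       = 8 * norm x ^ r / norm (of_nat (2*m+1) ^ 2 - 4 * x ^ 2)"
      by (simp add: norm_divide norm_mult norm_power)
    also have "\<dots> \<le> 8 * R ^ r / (n ^ 2 / 2)"
      using x n b R by (intro frac_le mult_left_mono power_mono) auto
    also have "\<dots> = 16 * R ^ r / n ^ 2" by simp
    also have "\<dots> \<le> 16 * R ^ r / real (Suc m) ^ 2"
      using n R by (intro divide_left_mono power_mono) auto
    finally show "norm (- (8 * x ^ r / (of_nat (2*m+1) ^ 2 - 4 * x ^ 2)))
           \<le> 16 * R ^ r * inverse (real (Suc m) ^ 2)" by (simp add: divide_inverse)
  qed
qed

lemma multicos_term_0: "multicos_term r m 0 = 0"
proof -
  have "LogP r 0 = 0" by (auto simp: LogP_def power_0_left intro!: sum.neutral)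
  then show ?thesis by (simp add: multicos_term_def)
qed

text \<open>The uniform bound holds on bounded sets only, so the domain is first cut down to a ball
  around 0 that contains x.\<close>

lemma multicos_series:
  assumes "x \<in> slit_half_plane (1/2)" "r \<ge> 1"
  shows multicos_series_summable: "summable (\<lambda>m. multicos_term r m x)"
    and multicos_series_deriv: "((\<lambda>x. \<Sum>m. multicos_term r m x) has_field_derivative
        (\<Sum>m. - (8 * x ^ r / (of_nat (2*m+1) ^ 2 - 4 * x ^ 2)))) (at x within slit_half_plane (1/2))"
proof -
  define R where "R = norm x + 1"
  define S where "S = slit_half_plane (1/2) \<inter> ball 0 R"
  have xS: "x \<in> S" using assms by (simp add: S_def R_def)
  have "\<exists>g. \<forall>x\<in>S. (\<lambda>m. multicos_term r m x) sums g x \<and> (g has_field_derivative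
            (\<Sum>m. - (8 * x ^ r / (of_nat (2*m+1) ^ 2 - 4 * x ^ 2)))) (at x within S)"
  proof (rule has_field_derivative_series)
    show "convex S" unfolding S_def by (intro convex_Int convex_slit_half_plane convex_ball)
    show "(multicos_term r m has_field_derivative - (8 * x ^ r / (of_nat (2*m+1) ^ 2 - 4 * x ^ 2))) (at x within S)"
      if "x \<in> S" for m x
      by (rule has_field_derivative_at_within[OF multicos_term_has_field_derivative])
        (use that assms(2) in \<open>auto simp: S_def slit_half_plane_def\<close>)
    show "uniform_limit S (\<lambda>N x. \<Sum>m<N. - (8 * x ^ r / (of_nat (2*m+1) ^ 2 - 4 * x ^ 2)))
           (\<lambda>x::complex. \<Sum>m. - (8 * x ^ r / (of_nat (2*m+1) ^ 2 - 4 * x ^ 2))) sequentially"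
      by (rule uniform_limit_multicos_term_deriv[of _ R]) (simp add: S_def)
    \<comment> \<open>Base point for the theorem on differentiating series: every term vanishes at
      0.\<close>
    show "0 \<in> S" by (simp add: S_def R_def slit_half_plane_def add_nonneg_pos)
    show "summable (\<lambda>m. multicos_term r m 0)" by (simp add: multicos_term_0)
  qed
  then obtain g where g: "\<And>x. x \<in> S \<Longrightarrow> (\<lambda>m. multicos_term r m x) sums g x"
    "(g has_field_derivative (\<Sum>m. - (8 * x ^ r / (of_nat (2*m+1) ^ 2 - 4 * x ^ 2)))) (at x within S)"
    using xS by blast
  show "summable (\<lambda>m. multicos_term r m x)" using g(1)[OF xS] by (simp add: sums_iff)
  have "((\<lambda>x. \<Sum>m. multicos_term r m x) has_field_derivative
        (\<Sum>m. - (8 * x ^ r / (of_nat (2*m+1) ^ 2 - 4 * x ^ 2)))) (at x within S)"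
    by (rule has_field_derivative_transform_within[OF g(2) zero_less_one xS])
      (use g(1) in \<open>simp add: sums_iff\<close>)
  \<comment> \<open>The ball is a neighbourhood of x, so intersecting with it leaves the filter
    unchanged.\<close>
  also have "at x within S = at x within slit_half_plane (1/2)"
    by (rule at_within_nhd[of _ "ball 0 R"]) (use xS in \<open>auto simp: S_def\<close>)
  finally show "((\<lambda>x. \<Sum>m. multicos_term r m x) has_field_derivative
        (\<Sum>m. - (8 * x ^ r / (of_nat (2*m+1) ^ 2 - 4 * x ^ 2)))) (at x within slit_half_plane (1/2))" .
qed

text \<open>Negating x exchanges the two logarithms; as the sign \<open>e\<close> satisfies
  \<open>e * e = 1\<close>, this is multiplication by \<open>e\<close>.\<close>

lemma multicos_term_uminus:
  "multicos_term r m (- x) = (-1) ^ (r - 1) * multicos_term r m x"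
proof -
  define e :: complex where "e = (-1) ^ (r - 1)"
  have "e * e = 1" by (simp add: e_def flip: power_add mult_2)
  then have "c * (b + e * a) = e * (c * (a + e * b))" for a b c by algebra
  note this[of "(of_nat (2*m+1) / 2) ^ (r - 1)" "LogP r (- 2 * x / of_nat (2*m+1))" "LogP r (2 * x / of_nat (2*m+1))"]
  moreover have "2 * (- x) = - 2 * x" "- 2 * (- x) = 2 * x" by simp_all
  ultimately show ?thesis by (simp only: multicos_term_def flip: e_def)
qed

lemma cos_pi_times_neq_0:
  assumes "x \<in> slit_half_plane (1/2)"
  shows "cos (of_real pi * x) \<noteq> 0"
proof
  assume "cos (of_real pi * x) = 0"
  then obtain n :: int where "of_real pi * x = of_real (n * pi) + of_real pi / 2"
    unfolding cos_eq_0 by auto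
  then have "of_real pi * x = of_real pi * of_real (n + 1/2)" by (simp add: algebra_simps)
  then have "x = of_real (n + 1/2)" using mult_cancel_left by (metis of_real_eq_0_iff pi_neq_zero)
  with assms have "\<bar>real_of_int n + 1/2\<bar> < 1/2" by (auto simp: slit_half_plane_def)
  then have "real_of_int n < 0" "-1 < real_of_int n" by linarith+
  then show False by simp
qed

section \<open>Polylogarithms inside the unit disc and on its boundary\<close>

lemma summable_polylog:
  assumes "norm (z::complex) < 1"
  shows "summable (\<lambda>n. z ^ (n+1) / of_nat (n+1) ^ k)"
proof (rule summable_comparison_test')
  show "summable (\<lambda>n. norm z ^ n)" using assms by (simp add: summable_geometric)
  fix n :: nat
  have "norm (z ^ (n+1) / of_nat (n+1) ^ k) = norm z ^ (n+1) / real (n+1) ^ k"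
    by (simp add: norm_divide norm_power norm_mult del: of_nat_Suc of_nat_add)
  also have "\<dots> \<le> norm z ^ (n+1) / 1"
    by (intro divide_left_mono one_le_power) auto
  also have "\<dots> \<le> norm z ^ n" using assms by (simp add: mult_left_le_one_le)
  finally show "norm (z ^ (n+1) / of_nat (n+1) ^ k) \<le> norm z ^ n" .
qed

lemma polylog_0: "norm z < 1 \<Longrightarrow> polylog 0 z = z / (1 - z)"
  using sums_mult[OF geometric_sums[of z], of z] by (simp add: polylog_def sums_iff)

lemma polylog_1:
  assumes "norm z < 1" shows "polylog 1 z = - Ln (1 - z)"
proof -
  have "(\<lambda>n. - (z ^ n / of_nat n)) sums Ln (1 - z)"
    using Ln_series'[of "-z"] assms by simp
  from sums_minus[OF this] have "(\<lambda>n. z ^ n / of_nat n) sums - Ln (1 - z)" by simp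
  then have "(\<lambda>n. z ^ Suc n / of_nat (Suc n)) sums - Ln (1 - z)"
    by (subst sums_Suc_iff) simp
  then show ?thesis by (simp add: polylog_def sums_iff)
qed

text \<open>Differentiating z^n/n^(k+1) gives z^(n-1)/n^k; the missing power of z is the quotient by
  z. The coefficients \<open>c\<close>, zero at index 0, recast the sum as a power series for the
  termwise theorem.\<close>

lemma polylog_Suc_has_field_derivative:
  assumes "norm z < 1" "z \<noteq> 0"
  shows "(polylog (Suc k) has_field_derivative polylog k z / z) (at z)"
proof -
  define c where "c n = (if n = 0 then 0 else 1 / of_nat n ^ Suc k :: complex)" for n
  have ps: "(\<lambda>n. c n * w ^ n) sums polylog (Suc k) w" if "norm w < 1" for w
  proof -
    have "(\<lambda>n. c (Suc n) * w ^ Suc n) sums polylog (Suc k) w"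
      using summable_sums[OF summable_polylog[OF that, of "Suc k"]]
      by (simp add: c_def polylog_def)
    from sums_Suc[OF this] show ?thesis by (simp add: c_def)
  qed
  have "((\<lambda>z. \<Sum>n. c n * z ^ n) has_field_derivative (\<Sum>n. diffs c n * z ^ n)) (at z)"
    by (rule termdiffs_strong'[of 1]) (use ps assms in \<open>auto simp: sums_iff\<close>)
  moreover have "(\<Sum>n. diffs c n * z ^ n) = polylog k z / z"
  proof -
    have "diffs c n * z ^ n = z ^ (n + 1) / of_nat (n + 1) ^ k / z" for n
      using assms(2) by (simp add: diffs_def c_def field_simps del: of_nat_Suc)
    then show ?thesis
      using suminf_divide[OF summable_polylog[OF assms(1), of k], of z] by (simp add: polylog_def)
  qed
  moreover have "\<forall>\<^sub>F w in nhds z. polylog (Suc k) w = (\<Sum>n. c n * w ^ n)"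
    using eventually_nhds_in_open[of "ball 0 1" z] assms(1)
    by (auto elim!: eventually_mono simp: ps[THEN sums_unique])
  ultimately show ?thesis by (subst DERIV_cong_ev[OF refl _ refl]) auto
qed

text \<open>For k at least 2 the majorant 1/n^k is summable and independent of z. This reaches the
  unit circle, onto which real x will be mapped.\<close>

lemma continuous_on_polylog:
  assumes "k \<ge> 2" shows "continuous_on (cball 0 1) (polylog k)"
proof -
  have "uniform_limit (cball 0 1) (\<lambda>N z. \<Sum>n<N. z ^ (n+1) / of_nat (n+1) ^ k)
          (\<lambda>z::complex. \<Sum>n. z ^ (n+1) / of_nat (n+1) ^ k) sequentially"
  proof (rule Weierstrass_m_test)
    show "summable (\<lambda>n. inverse (real (Suc n) ^ k))"
      using inverse_power_summable[of k, where ?'a=real] assms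
      by (subst summable_Suc_iff[of "\<lambda>n. inverse (real n ^ k)"]) simp
    fix n and z :: complex assume "z \<in> cball 0 1"
    then have z: "norm z \<le> 1" by simp
    have "norm (z ^ (n+1) / of_nat (n+1) ^ k) = norm z ^ (n+1) / real (n+1) ^ k"
      by (simp add: norm_divide norm_power norm_mult del: of_nat_Suc of_nat_add)
    also have "\<dots> \<le> 1 / real (n+1) ^ k"
      using z by (intro divide_right_mono power_le_one) auto
    finally show "norm (z ^ (n+1) / of_nat (n+1) ^ k) \<le> inverse (real (Suc n) ^ k)"
      by (simp add: divide_inverse)
  qed
  then show ?thesis unfolding polylog_def
    by (rule uniform_limit_theorem[rotated])
      (auto intro!: always_eventually continuous_intros simp del: of_nat_Suc of_nat_add)
qed

lemma summable_polylog_circle: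
  assumes "k \<ge> 2" "norm (z::complex) \<le> 1"
  shows "summable (\<lambda>n. z ^ (n+1) / of_nat (n+1) ^ k)"
proof (rule summable_comparison_test')
  show "summable (\<lambda>n. inverse (real (Suc n) ^ k))"
    using inverse_power_summable[of k, where ?'a=real] assms
    by (subst summable_Suc_iff[of "\<lambda>n. inverse (real n ^ k)"]) simp
  fix n :: nat
  have "norm (z ^ (n+1) / of_nat (n+1) ^ k) = norm z ^ (n+1) / real (n+1) ^ k"
    by (simp add: norm_divide norm_power norm_mult del: of_nat_Suc of_nat_add)
  also have "\<dots> \<le> 1 / real (n+1) ^ k"
    using assms by (intro divide_right_mono power_le_one) auto
  finally show "norm (z ^ (n+1) / of_nat (n+1) ^ k) \<le> inverse (real (Suc n) ^ k)"
    by (simp add: divide_inverse)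
qed

text \<open>This value determines the constant of integration. The sign appears because
  \<open>zetaE\<close> starts with +1 and the polylogarithm at -1 starts with -1.\<close>

lemma polylog_minus_1:
  assumes "k \<ge> 2" shows "polylog k (-1) = - of_real (zetaE k)"
proof -
  have "summable (\<lambda>n. of_real ((-1) ^ (n+1) / real (n+1) ^ k) :: complex)"
    using summable_polylog_circle[OF assms, of "-1"] by simp
  then have s: "summable (\<lambda>n. (-1) ^ (n+1) / real (n+1) ^ k)"
    by (simp only: summable_of_real_iff)
  have "polylog k (-1) = of_real (\<Sum>n. (-1) ^ (n+1) / real (n+1) ^ k)"
    unfolding polylog_def suminf_of_real[OF s] by simp
  also have "(\<Sum>n. (-1) ^ (n+1) / real (n+1) ^ k) = - zetaE k"
    using suminf_minus[OF summable_minus[OF s]] s by (simp add: zetaE_def summable_minus_iff)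
  finally show ?thesis by simp
qed

section \<open>The logarithm of the multiple cosine and its derivative\<close>

text \<open>This is the exponent itself and not \<open>Ln\<close> of the product, so identities hold
  without ambiguity by multiples of 2 pi i.\<close>

definition log_multicos :: "nat \<Rightarrow> complex \<Rightarrow> complex" where
  "log_multicos r x = (\<Sum>m. multicos_term r m x)"

lemma multicos_eq_exp: "multicos r x = exp (log_multicos r x)"
  by (simp only: multicos_def log_multicos_def multicos_term_def)

lemma log_multicos_0: "log_multicos r 0 = 0"
  by (simp add: log_multicos_def multicos_term_0)

text \<open>Once x^(r-1) is taken out of the termwise derivatives, the partial fractions of the
  tangent remain.\<close>

lemma log_multicos_has_field_derivative:
  assumes "x \<in> slit_half_plane (1/2)" "r \<ge> 1"
  shows "(log_multicos r has_field_derivative - (of_real pi * x ^ (r - 1) * tan (of_real pi * x)))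
           (at x within slit_half_plane (1/2))"
proof -
  have "(\<lambda>m. - (x ^ (r - 1)) * (8 * x / (of_nat (2*m+1) ^ 2 - 4 * x ^ 2))) sums
          (- (x ^ (r - 1)) * (of_real pi * tan (of_real pi * x)))"
    by (intro sums_mult tan_partial_fractions cos_pi_times_neq_0 assms)
  moreover have "- (x ^ (r - 1)) * (8 * x / (of_nat (2*m+1) ^ 2 - 4 * x ^ 2)) =
      - (8 * x ^ r / (of_nat (2*m+1) ^ 2 - 4 * x ^ 2))" for m
    using assms(2) by (cases r) auto
  ultimately have "(\<Sum>m. - (8 * x ^ r / (of_nat (2*m+1) ^ 2 - 4 * x ^ 2))) =
      - (of_real pi * x ^ (r - 1) * tan (of_real pi * x))"
    by (simp only: sums_iff) (simp add: mult_ac)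
  with multicos_series_deriv[OF assms] show ?thesis
    unfolding log_multicos_def[abs_def] by simp
qed

text \<open>Summability at x passes to -x through the termwise parity, which gives access to the
  upper half-plane.\<close>

lemma log_multicos_uminus:
  assumes "x \<in> slit_half_plane (1/2)" "r \<ge> 1"
  shows "log_multicos r (- x) = (-1) ^ (r - 1) * log_multicos r x"
  unfolding log_multicos_def multicos_term_uminus
  by (rule suminf_mult[OF multicos_series_summable[OF assms]])

text \<open>For q = exp(-pi i x) one has |q| = exp(pi Im x). Moreover Re q > -1: below the real axis
  because |q| < 1, and on it because q has real part cos(pi x) with |x| < 1. So 1 + q avoids the cut
  of \<open>Ln\<close>.\<close>

lemma norm_exp_slit:
  assumes "x \<in> slit_half_plane 1"
  shows "norm (exp (- of_real pi * \<i> * x)) \<le> 1" and "1 + exp (- of_real pi * \<i> * x) \<notin> \<real>\<^sub>\<le>\<^sub>0"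
    and "Im x < 0 \<Longrightarrow> norm (exp (- of_real pi * \<i> * x)) < 1"
proof -
  define q where "q = exp (- of_real pi * \<i> * x)"
  have n: "norm q = exp (pi * Im x)" by (simp add: q_def)
  show lt: "norm (exp (- of_real pi * \<i> * x)) < 1" if "Im x < 0"
    unfolding q_def[symmetric] n using that by (simp add: mult_pos_neg)
  show "norm (exp (- of_real pi * \<i> * x)) \<le> 1"
    unfolding q_def[symmetric] n using assms by (auto simp: slit_half_plane_def mult_le_0_iff)
  have "Re q > -1"
  proof (cases "Im x < 0")
    case True
    with lt have "norm q < 1" by (simp only: q_def)
    then show ?thesis using abs_Re_le_cmod[of q] by linarith
  next
    case False
    then have im: "Im x = 0" and re: "\<bar>Re x\<bar> < 1" using assms by (auto simp: slit_half_plane_def)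
    have "Re q = cos (pi * \<bar>Re x\<bar>)" using im by (simp add: q_def Re_exp abs_if)
    also have "\<dots> > cos pi" using re by (intro cos_monotone_0_pi) auto
    finally show ?thesis by simp
  qed
  then show "1 + exp (- of_real pi * \<i> * x) \<notin> \<real>\<^sub>\<le>\<^sub>0"
    unfolding q_def[symmetric] by (simp add: complex_nonpos_Reals_iff)
qed

section \<open>Derivative of the polylogarithm side in the lower half-plane\<close>

text \<open>The inner derivative contributes a factor z that cancels the quotient by z, so lowering
  the order costs only the constant -pi i.\<close>

lemma polylog_exp_has_field_derivative:
  assumes "Im x < 0"
  shows "((\<lambda>x. polylog (Suc k) (- exp (- of_real pi * \<i> * x))) has_field_derivative
           - (of_real pi * \<i>) * polylog k (- exp (- of_real pi * \<i> * x))) (at x)"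
proof -
  define z where "z = - exp (- of_real pi * \<i> * x)"
  have z: "norm z < 1" "z \<noteq> 0" using norm_exp_slit(3)[of x] assms by (auto simp: z_def slit_half_plane_def)
  have "((\<lambda>x. - exp (- of_real pi * \<i> * x)) has_field_derivative (- of_real pi * \<i> * z)) (at x)"
    unfolding z_def by (auto intro!: derivative_eq_intros)
  from DERIV_chain2[OF polylog_Suc_has_field_derivative[OF z, unfolded z_def] this]
  have "((\<lambda>x. polylog (Suc k) (- exp (- of_real pi * \<i> * x))) has_field_derivative
           polylog k z / z * (- of_real pi * \<i> * z)) (at x)" by (simp only: z_def)
  moreover have "polylog k z / z * (- of_real pi * \<i> * z) = - (of_real pi * \<i>) * polylog k z"
    using z by simp
  ultimately show ?thesis by (simp only: z_def)
qed

text \<open>By the product rule, differentiating the polylogarithm in summand k cancels against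
  differentiating the power of x in summand k+1, and the sum telescopes.\<close>

lemma polylog_sum_has_field_derivative:
  assumes "Im x < 0" "r \<ge> 1"
  shows "((\<lambda>x. \<Sum>k<r. (of_real pi * \<i>) ^ k / fact k * polylog (r - k) (- exp (- of_real pi * \<i> * x)) * x ^ k)
          has_field_derivative
          - ((of_real pi * \<i>) ^ r / fact (r - 1) * polylog 0 (- exp (- of_real pi * \<i> * x)) * x ^ (r - 1))) (at x)"
proof -
  define w where "w = of_real pi * \<i>"
  define L where "L k = polylog k (- exp (- of_real pi * \<i> * x))" for k
  \<comment> \<open>\<open>U k\<close> is the part of the derivative of summand k that comes from
    x^k. It is 0 for k = 0, so only \<open>U r\<close>, with the polylogarithm of order 0,
    survives.\<close>
  define U where "U k = (if k = 0 then 0 else w ^ k / fact (k - 1) * L (r - k) * x ^ (k - 1))" for k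
  have "((\<lambda>x. w ^ k / fact k * polylog (r - k) (- exp (- of_real pi * \<i> * x)) * x ^ k)
          has_field_derivative (U k - U (Suc k))) (at x)" if k: "k < r" for k
  proof -
    obtain d where d: "r - k = Suc d" "r - Suc k = d" using k by (metis Suc_diff_Suc)
    have "((\<lambda>x. w ^ k / fact k * polylog (Suc d) (- exp (- of_real pi * \<i> * x)) * x ^ k)
            has_field_derivative
          (w ^ k / fact k * (- w * L d)) * x ^ k + (of_nat k * x ^ (k - 1)) * (w ^ k / fact k * L (Suc d))) (at x)"
      unfolding L_def w_def
      by (intro DERIV_mult DERIV_cmult polylog_exp_has_field_derivative assms) (auto intro!: derivative_eq_intros)
    moreover have "(w ^ k / fact k * (- w * L d)) * x ^ k + (of_nat k * x ^ (k - 1)) * (w ^ k / fact k * L (Suc d))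
                = U k - U (Suc k)"
    proof -
      have "U k = of_nat k * w ^ k / fact k * L (Suc d) * x ^ (k - 1)"
        using d by (cases k) (simp_all add: U_def fact_Suc del: of_nat_Suc power_Suc)
      moreover have "U (Suc k) = w ^ k * w / fact k * L d * x ^ k" by (simp add: U_def d)
      ultimately show ?thesis by (simp add: mult_ac)
    qed
    ultimately show ?thesis by (simp only: d)
  qed
  then have "((\<lambda>x. \<Sum>k<r. w ^ k / fact k * polylog (r - k) (- exp (- of_real pi * \<i> * x)) * x ^ k)
          has_field_derivative (\<Sum>k<r. U k - U (Suc k))) (at x)"
    by (intro DERIV_sum) auto
  also have "(\<Sum>k<r. U k - U (Suc k)) = - (w ^ r / fact (r - 1) * L 0 * x ^ (r - 1))"
    unfolding sum_lessThan_telescope' using assms(2) by (simp add: U_def)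
  finally show ?thesis unfolding w_def L_def .
qed

text \<open>Both sides are rational in u = exp(pi i x/2), with exp(-pi i x) = 1/u^2. The summand pi
  i/2 matches the derivative of (pi i/r)(x/2)^r.\<close>

lemma tan_half_eq_exp:
  assumes "Im x < 0"
  shows "of_real pi * \<i> * polylog 0 (- exp (- of_real pi * \<i> * x)) + of_real pi * \<i> / 2
           = - (of_real pi / 2 * tan (of_real pi * (x / 2)))"
proof -
  define e where "e = exp (- of_real pi * \<i> * x)"
  define u where "u = exp (\<i> * (of_real pi * (x / 2)))"
  have u0: "u \<noteq> 0" by (simp add: u_def)
  have e1: "norm e < 1" using norm_exp_slit(3)[of x] assms by (auto simp: e_def slit_half_plane_def)
  then have e0: "1 + e \<noteq> 0" by (metis add_eq_0_iff norm_minus_cancel norm_one less_irrefl)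
  have "u * u * e = 1" unfolding u_def e_def exp_add[symmetric] by (simp add: algebra_simps)
  then have e: "e = 1 / (u * u)" using u0 by (simp add: field_simps)
  have nz: "u * u + 1 \<noteq> 0" using e0 u0 by (simp add: e field_simps)
  have "tan (of_real pi * (x / 2)) = - \<i> * (u * u - 1) / (u * u + 1)"
    unfolding tan_def sin_exp_eq cos_exp_eq exp_minus u_def[symmetric] mult_minus_left
    using u0 nz by (simp add: divide_simps)
  moreover have "polylog 0 (- e) = - 1 / (u * u + 1)"
    using polylog_0[of "-e"] e1 u0 nz by (simp add: e divide_simps)
  ultimately show ?thesis unfolding e_def[symmetric]
    using nz by (simp only:) (simp add: divide_simps, simp add: algebra_simps)
qed

section \<open>Integration of the derivative identity, up to the real boundary\<close>

text \<open>\<open>Li\<^sub>1\<close> is replaced by its closed form so that the function stays continuous on the unit circle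
  away from 1, without having to discuss conditional convergence there.\<close>
definition polylog_ext :: "nat \<Rightarrow> complex \<Rightarrow> complex" where
  "polylog_ext k z = (if k = 1 then - Ln (1 - z) else polylog k z)"

lemma polylog_ext_eq: "norm z < 1 \<Longrightarrow> polylog_ext k z = polylog k z"
  using polylog_1[of z] by (simp add: polylog_ext_def)

lemma continuous_on_polylog_ext:
  assumes "k \<ge> 1"
  shows "continuous_on (slit_half_plane 1) (\<lambda>x. polylog_ext k (- exp (- of_real pi * \<i> * x)))"
proof (cases "k = 1")
  case True
  have "continuous_on (slit_half_plane 1) (\<lambda>x. - Ln (1 + exp (- of_real pi * \<i> * x)))"
    by (intro continuous_intros) (use norm_exp_slit(2) in blast)
  then show ?thesis using True by (simp add: polylog_ext_def)
next
  case False
  have "continuous_on (slit_half_plane 1) (\<lambda>x. polylog k (- exp (- of_real pi * \<i> * x)))"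
    by (rule continuous_on_compose2[OF continuous_on_polylog])
      (use False assms norm_exp_slit(1) in \<open>auto intro!: continuous_intros\<close>)
  then show ?thesis using False by (simp add: polylog_ext_def)
qed

text \<open>Using \<open>polylog_ext\<close> gives one identity for the lower half-plane and the
  interval (-1, 1) together, from which all four formulas are derived.\<close>

lemma log_multicos_polylog_ext:
  assumes r: "r \<ge> 2" and x: "x \<in> slit_half_plane 1"
  shows "log_multicos r (x / 2) =
        - (fact (r - 1) / (2 * of_real pi * \<i>) ^ (r - 1)) *
          (\<Sum>k<r. (of_real pi * \<i>) ^ k / fact k * polylog_ext (r - k) (- exp (- of_real pi * \<i> * x)) * x ^ k)
        + of_real pi * \<i> / of_nat r * (x / 2) ^ r
        - fact (r - 1) / (2 * of_real pi * \<i>) ^ (r - 1) * of_real (zetaE r)"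
proof -
  define w where "w = of_real pi * \<i>"
  have w0: "w \<noteq> 0" by (simp add: w_def)
  define c where "c = fact (r - 1) / (2 * w) ^ (r - 1)"
  \<comment> \<open>The parameter \<open>P\<close> allows differentiating with
    \<open>polylog\<close> and arguing by continuity with \<open>polylog_ext\<close>; the two agree
    on the open half-plane \<open>H\<close>.\<close>
  define Q where "Q P x = - c * (\<Sum>k<r. w ^ k / fact k * P (r - k) (- exp (- of_real pi * \<i> * x)) * x ^ k)
      + w / of_nat r * (x / 2) ^ r - c * of_real (zetaE r)" for P :: "nat \<Rightarrow> complex \<Rightarrow> complex" and x
  define h where "h x = log_multicos r (x / 2) - Q polylog_ext x" for x
  have half: "y / 2 \<in> slit_half_plane (1/2)" if "y \<in> slit_half_plane 1" for y
    using that by (auto simp: slit_half_plane_def)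
  have cont: "continuous_on (slit_half_plane 1) h"
  proof -
    have "continuous_on (slit_half_plane (1/2)) (log_multicos r)"
      using log_multicos_has_field_derivative[of _ r] r by (intro DERIV_continuous_on) auto
    then have "continuous_on (slit_half_plane 1) (\<lambda>x. log_multicos r (x / 2))"
      by (rule continuous_on_compose2) (use half in \<open>auto intro!: continuous_intros\<close>)
    moreover have "continuous_on (slit_half_plane 1) (Q polylog_ext)"
      unfolding Q_def using r by (intro continuous_intros continuous_on_polylog_ext) auto
    ultimately show ?thesis unfolding h_def by (intro continuous_intros)
  qed
  define H where "H = {x. Im x < 0}"
  have H: "open H" "convex H" unfolding H_def by (simp_all add: open_halfspace_Im_lt convex_halfspace_Im_lt)
  have der: "(h has_field_derivative 0) (at y within H)" if y: "y \<in> H" for y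
  proof -
    have imy: "Im y < 0" using y by (simp add: H_def)
    have sub: "H \<subseteq> slit_half_plane (1/2)" by (auto simp: H_def slit_half_plane_def)
    have "(log_multicos r has_field_derivative - (of_real pi * (y/2) ^ (r - 1) * tan (of_real pi * (y/2)))) (at (y/2) within H)"
      by (rule has_field_derivative_subset[OF log_multicos_has_field_derivative sub])
         (use imy r in \<open>auto simp: slit_half_plane_def\<close>)
    then have "(log_multicos r has_field_derivative - (of_real pi * (y/2) ^ (r - 1) * tan (of_real pi * (y/2)))) (at (y/2))"
      using at_within_open[OF _ H(1)] imy by (simp add: H_def)
    moreover have "((\<lambda>x. x / 2) has_field_derivative 1/2) (at y)"
      by (auto intro!: derivative_eq_intros)
    ultimately have F: "((\<lambda>x. log_multicos r (x / 2)) has_field_derivative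
         - (of_real pi * (y/2) ^ (r - 1) * tan (of_real pi * (y/2))) * (1/2)) (at y)"
      by (rule DERIV_chain2)
    have pw: "((\<lambda>x. w / of_nat r * (x / 2) ^ r) has_field_derivative w / 2 * (y / 2) ^ (r - 1)) (at y)"
      using r by (auto intro!: derivative_eq_intros)
    have "(Q polylog has_field_derivative - c * - (w ^ r / fact (r - 1) * polylog 0 (- exp (- of_real pi * \<i> * y)) * y ^ (r - 1))
          + w / 2 * (y / 2) ^ (r - 1) - 0) (at y)"
      unfolding Q_def using polylog_sum_has_field_derivative[OF imy, of r] r
      by (intro DERIV_diff DERIV_add DERIV_cmult pw DERIV_const) (auto simp: w_def)
    \<comment> \<open>The factorial and w^(r-1) cancel against \<open>c\<close>; its remaining
      2^(r-1) turns y^(r-1) into (y/2)^(r-1).\<close>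
    also have "- c * - (w ^ r / fact (r - 1) * polylog 0 (- exp (- of_real pi * \<i> * y)) * y ^ (r - 1))
          + w / 2 * (y / 2) ^ (r - 1) - 0 = (y / 2) ^ (r - 1) * (w * polylog 0 (- exp (- of_real pi * \<i> * y)) + w / 2)"
    proof -
      obtain s where s: "r = Suc s" using r by (cases r) auto
      show ?thesis using w0 unfolding c_def s by (simp add: field_simps power_mult_distrib)
    qed
    also have "w * polylog 0 (- exp (- of_real pi * \<i> * y)) + w / 2 = - (of_real pi / 2 * tan (of_real pi * (y / 2)))"
      unfolding w_def by (rule tan_half_eq_exp[OF imy])
    finally have G: "(Q polylog has_field_derivative (y / 2) ^ (r - 1) * - (of_real pi / 2 * tan (of_real pi * (y / 2)))) (at y)" .
    have "((\<lambda>x. log_multicos r (x / 2) - Q polylog x) has_field_derivative 0) (at y within H)"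
      by (rule has_field_derivative_at_within[OF DERIV_cong[OF DERIV_diff[OF F G]]]) (simp add: algebra_simps)
    moreover have "Q polylog_ext x = Q polylog x" if "x \<in> H" for x
    proof -
      have "norm (- exp (- of_real pi * \<i> * x)) < 1"
        using norm_exp_slit(3)[of x] that by (simp add: H_def slit_half_plane_def)
      then show ?thesis unfolding Q_def by (simp only: polylog_ext_eq)
    qed
    ultimately show ?thesis
      by - (rule has_field_derivative_transform_within[OF _ zero_less_one y], auto simp: h_def)
  qed
  obtain C where C: "\<And>y. y \<in> H \<Longrightarrow> h y = C"
    using has_field_derivative_zero_constant[OF H(2) der] by auto
  have hC: "h y = C" if y: "y \<in> slit_half_plane 1" for y
  proof -
    \<comment> \<open>A point of the slit half-plane is approached vertically from below, through
      points of \<open>H\<close> where h is already known to be \<open>C\<close>.\<close>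
    define Y where "Y n = y - \<i> * of_real (inverse (real (Suc n)))" for n
    have "Y \<longlonglongrightarrow> y - \<i> * of_real 0"
      unfolding Y_def by (intro tendsto_intros LIMSEQ_inverse_real_of_nat)
    then have lim: "Y \<longlonglongrightarrow> y" by simp
    have YH: "Y n \<in> H" for n
    proof -
      have "Im y \<le> 0" "inverse (real (Suc n)) > 0" using y by (auto simp: slit_half_plane_def)
      moreover have "Im (y - \<i> * of_real t) = Im y - t" for t by simp
      ultimately show ?thesis unfolding H_def Y_def by (simp only: mem_Collect_eq)
    qed
    then have "Y n \<in> slit_half_plane 1" for n by (auto simp: H_def slit_half_plane_def)
    then have "(\<lambda>n. h (Y n)) \<longlonglongrightarrow> h y"
      by (intro continuous_on_tendsto_compose[OF cont lim y]) auto
    then show ?thesis using C[OF YH] by (simp add: LIMSEQ_const_iff)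
  qed
  \<comment> \<open>At 0 only the summand k = 0 remains, and its value at -1 cancels the
    \<open>zetaE\<close> term.\<close>
  have "h 0 = 0"
  proof -
    obtain s where s: "r = Suc s" using r by (cases r) auto
    have "(\<Sum>k<r. w ^ k / fact k * polylog_ext (r - k) (- exp (- of_real pi * \<i> * 0)) * 0 ^ k) = polylog_ext r (- 1)"
      unfolding s sum.lessThan_Suc_shift by simp
    also have "\<dots> = - of_real (zetaE r)" using r polylog_minus_1[of r] by (simp add: polylog_ext_def)
    finally show ?thesis using r by (simp add: h_def Q_def log_multicos_0)
  qed
  moreover have "(0::complex) \<in> slit_half_plane 1" by (simp add: slit_half_plane_def)
  ultimately have "h x = 0" using hC[of 0] hC[OF x] by simp
  then show ?thesis unfolding h_def Q_def c_def w_def by (simp add: mult.assoc)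
qed

lemma log_multicos_lower:
  assumes "r \<ge> 2" "Im x < 0"
  shows "log_multicos r (x / 2) =
        - (of_nat (fact (r - 1)) / (2 * of_real pi * \<i>) ^ (r - 1)) *
          (\<Sum>k=0..r-1. (of_real pi * \<i>) ^ k / of_nat (fact k) *
              polylog (r - k) (- exp (- of_real pi * \<i> * x)) * x ^ k)
        + of_real pi * \<i> / of_nat r * (x / 2) ^ r
        - of_nat (fact (r - 1)) / (2 * of_real pi * \<i>) ^ (r - 1) * of_real (zetaE r)"
proof -
  have x: "x \<in> slit_half_plane 1" using assms by (simp add: slit_half_plane_def)
  have n: "norm (- exp (- of_real pi * \<i> * x)) < 1"
    using norm_exp_slit(3)[OF x] assms by simp
  have "{..<r} = {0..r-1}" using assms by auto
  then show ?thesis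
    unfolding log_multicos_polylog_ext[OF assms(1) x] polylog_ext_eq[OF n] by (simp only: of_nat_fact)
qed

text \<open>The lower formula at -x is combined with parity. The sign \<open>e\<close> is absorbed
  by (2 pi i)^(r-1) = e (-2 pi i)^(r-1), (-x)^r = -e x^r and \<open>e * e = 1\<close>.\<close>

lemma log_multicos_upper:
  assumes "r \<ge> 2" "Im x > 0"
  shows "log_multicos r (x / 2) =
        - (of_nat (fact (r - 1)) / (- 2 * of_real pi * \<i>) ^ (r - 1)) *
          (\<Sum>k=0..r-1. (- of_real pi * \<i>) ^ k / of_nat (fact k) *
              polylog (r - k) (- exp (of_real pi * \<i> * x)) * x ^ k)
        - of_real pi * \<i> / of_nat r * (x / 2) ^ r
        - of_nat (fact (r - 1)) / (- 2 * of_real pi * \<i>) ^ (r - 1) * of_real (zetaE r)"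
proof -
  define e :: complex where "e = (-1) ^ (r - 1)"
  have ee: "e * e = 1" by (simp add: e_def flip: power_add mult_2)
  have "log_multicos r (x / 2) = log_multicos r (- (- x / 2))" by simp
  also have "\<dots> = e * log_multicos r (- x / 2)"
    unfolding e_def using assms by (intro log_multicos_uminus) (auto simp: slit_half_plane_def)
  also have "log_multicos r (- x / 2) = - (of_nat (fact (r - 1)) / (2 * of_real pi * \<i>) ^ (r - 1)) *
          (\<Sum>k=0..r-1. (of_real pi * \<i>) ^ k / of_nat (fact k) *
              polylog (r - k) (- exp (- of_real pi * \<i> * - x)) * (- x) ^ k)
        + of_real pi * \<i> / of_nat r * (- x / 2) ^ r
        - of_nat (fact (r - 1)) / (2 * of_real pi * \<i>) ^ (r - 1) * of_real (zetaE r)"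
    using assms by (intro log_multicos_lower) auto
  also have "(\<Sum>k=0..r-1. (of_real pi * \<i>) ^ k / of_nat (fact k) *
              polylog (r - k) (- exp (- of_real pi * \<i> * - x)) * (- x) ^ k) =
        (\<Sum>k=0..r-1. (- of_real pi * \<i>) ^ k / of_nat (fact k) *
              polylog (r - k) (- exp (of_real pi * \<i> * x)) * x ^ k)" (is "_ = ?S")
  proof (rule sum.cong)
    fix k
    have "(of_real pi * \<i>) ^ k * (- x) ^ k = (- of_real pi * \<i>) ^ k * x ^ k"
      by (simp flip: power_mult_distrib)
    moreover have "a / f * p * y = a * y * (p / f)" for a f p y :: complex by simp
    ultimately show "(of_real pi * \<i>) ^ k / of_nat (fact k) * polylog (r - k) (- exp (- of_real pi * \<i> * - x)) * (- x) ^ k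
       = (- of_real pi * \<i>) ^ k / of_nat (fact k) * polylog (r - k) (- exp (of_real pi * \<i> * x)) * x ^ k"
      by (simp only:) simp
  qed simp
  also have "(2 * of_real pi * \<i>) ^ (r - 1) = e * (- 2 * of_real pi * \<i>) ^ (r - 1)"
    unfolding e_def power_mult_distrib[symmetric] by simp
  also have "(- x / 2) ^ r = - (e * (x / 2) ^ r)"
    using power_minus[of "x / 2" r] assms(1) by (cases r) (auto simp: e_def)
  finally have "log_multicos r (x / 2) = e * (- (of_nat (fact (r - 1)) / (e * (- 2 * of_real pi * \<i>) ^ (r - 1))) * ?S
     + of_real pi * \<i> / of_nat r * - (e * (x / 2) ^ r)
     - of_nat (fact (r - 1)) / (e * (- 2 * of_real pi * \<i>) ^ (r - 1)) * of_real (zetaE r))" .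
  moreover have "e * (- (F / (e * D)) * S + W * - (e * X) - F / (e * D) * Z) = - (F / D) * S - W * X - F / D * Z"
    for F D S W X Z
  proof -
    have e0: "e \<noteq> 0" using ee by auto
    have "e * (F / (e * D)) = F / D" using e0 by simp
    then show ?thesis using ee by algebra
  qed
  ultimately show ?thesis by (simp only:)
qed

section \<open>Real arguments: taking real parts on the boundary\<close>

text \<open>All arguments of \<open>Ln\<close> are positive reals here, so the real part carries the
  whole value.\<close>

lemma log_multicos_real:
  assumes "\<bar>x\<bar> < 1" "r \<ge> 1"
  shows "log_multicos r (of_real x / 2) = of_real (Re (log_multicos r (of_real x / 2)))"
proof -
  have LogP: "LogP r (of_real y) \<in> \<real>" if "y < 1" for y
  proof -
    have "Ln (1 - of_real y) = of_real (ln (1 - y))"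
      using that by (simp flip: Ln_of_real)
    then show ?thesis unfolding LogP_def by (auto intro!: Reals_add sum_in_Reals)
  qed
  have "multicos_term r m (of_real x / 2) \<in> \<real>" for m
  proof -
    define n where "n = real (2*m+1)"
    have n: "n \<ge> 1" by (simp add: n_def)
    have "x < n" "- x < n" using assms n by auto
    then have "x / n < 1" "- x / n < 1" using n by (simp_all add: field_simps)
    from LogP[OF this(1)] LogP[OF this(2)] have "LogP r (of_real x / of_real n) \<in> \<real>" "LogP r (- of_real x / of_real n) \<in> \<real>"
      by simp_all
    moreover have "(of_nat (2*m+1) :: complex) = of_real n" by (simp add: n_def)
    ultimately show ?thesis unfolding multicos_term_def by (auto intro!: Reals_mult Reals_add Reals_power)
  qed
  then have eq: "multicos_term r m (of_real x / 2) = of_real (Re (multicos_term r m (of_real x / 2)))" for m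
    by (metis of_real_Re)
  have x: "of_real x / 2 \<in> slit_half_plane (1/2)" using assms by (simp add: slit_half_plane_def)
  have "log_multicos r (of_real x / 2) = of_real (\<Sum>m. Re (multicos_term r m (of_real x / 2)))"
    unfolding log_multicos_def suminf_of_real[OF summable_Re[OF multicos_series_summable[OF x assms(2)]]]
    by (subst eq) (rule refl)
  then show ?thesis by simp
qed

text \<open>De Moivre's formula; the minus sign of the sine series reflects the exponent -pi i
  x.\<close>

lemma polylog_unit_circle:
  assumes "k \<ge> 2"
  shows "Re (polylog k (- exp (- of_real pi * \<i> * of_real x))) =
           (\<Sum>n. (-1) ^ (n+1) * cos (pi * real (n+1) * x) / real (n+1) ^ k)" (is ?re)
    and "Im (polylog k (- exp (- of_real pi * \<i> * of_real x))) =
           - (\<Sum>n. (-1) ^ (n+1) * sin (pi * real (n+1) * x) / real (n+1) ^ k)" (is ?im)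
proof -
  define z where "z = - exp (- of_real pi * \<i> * of_real x)"
  have z: "norm z \<le> 1" by (simp add: z_def)
  note s = summable_polylog_circle[OF assms z]
  have zp: "z ^ n = (-1) ^ n * cis (- (pi * real n * x))" for n
  proof -
    have "z ^ n = (-1) ^ n * exp (- of_real pi * \<i> * of_real x) ^ n"
      unfolding z_def by (rule power_minus)
    also have "exp (- of_real pi * \<i> * of_real x) ^ n = cis (- (pi * real n * x))"
      by (simp add: cis_conv_exp mult_ac flip: exp_of_nat_mult)
    finally show ?thesis .
  qed
  have t: "z ^ (n+1) / of_nat (n+1) ^ k =
     of_real ((-1) ^ (n+1) / real (n+1) ^ k) * cis (- (pi * real (n+1) * x))" for n
    unfolding zp by (simp del: of_nat_Suc of_nat_add power_Suc)
  have ri: "Re (of_real a * b) = a * Re b" "Im (of_real a * b) = a * Im b" for a b by simp_all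
  have re: "Re (z ^ (n+1) / of_nat (n+1) ^ k) = (-1) ^ (n+1) * cos (pi * real (n+1) * x) / real (n+1) ^ k"
   and im: "Im (z ^ (n+1) / of_nat (n+1) ^ k) = - ((-1) ^ (n+1) * sin (pi * real (n+1) * x) / real (n+1) ^ k)" for n
    unfolding t ri by simp_all
  have "Re (polylog k z) = (\<Sum>n. Re (z ^ (n+1) / of_nat (n+1) ^ k))"
    unfolding polylog_def by (rule Re_suminf[OF s])
  then show ?re unfolding z_def[symmetric] re .
  have "Im (polylog k z) = (\<Sum>n. Im (z ^ (n+1) / of_nat (n+1) ^ k))"
    unfolding polylog_def by (rule Im_suminf[OF s])
  also have "\<dots> = - (\<Sum>n. (-1) ^ (n+1) * sin (pi * real (n+1) * x) / real (n+1) ^ k)"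
    unfolding im by (rule suminf_minus) (use summable_minus[OF summable_Im[OF s]] in \<open>simp only: im minus_minus\<close>)
  finally show ?im unfolding z_def[symmetric] .
qed

text \<open>Half-angle factorisation: 1 + exp(-i t) = 2 cos(t/2) exp(-i t/2). It is the source of
  the cosine factor in the real formulas.\<close>

lemma Re_Ln_one_plus_exp:
  assumes "\<bar>x\<bar> < 1"
  shows "cos (pi * x / 2) > 0"
    and "Re (Ln (1 + exp (- of_real pi * \<i> * of_real x))) = ln (2 * cos (pi * x / 2))"
proof -
  have "\<bar>pi * x / 2\<bar> < pi / 2" using assms by (simp add: abs_mult)
  then show pos: "cos (pi * x / 2) > 0" by (intro cos_gt_zero_pi) linarith+
  have "1 + exp (- of_real pi * \<i> * of_real x) = of_real (2 * cos (pi * x / 2)) * cis (- (pi * x / 2))"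
  proof -
    have "1 + exp (- of_real pi * \<i> * of_real x) = cis (pi * x / 2) * cis (- (pi * x / 2)) + cis (- (pi * x / 2)) * cis (- (pi * x / 2))"
      unfolding cis_mult by (simp add: cis_conv_exp mult_ac)
    also have "\<dots> = (cis (pi * x / 2) + cis (- (pi * x / 2))) * cis (- (pi * x / 2))"
      by (simp add: distrib_right)
    also have "cis (pi * x / 2) + cis (- (pi * x / 2)) = of_real (2 * cos (pi * x / 2))"
      by (simp add: complex_eq_iff)
    finally show ?thesis .
  qed
  then have n: "norm (1 + exp (- of_real pi * \<i> * of_real x)) = 2 * cos (pi * x / 2)"
    using pos by (simp add: norm_mult)
  then have "1 + exp (- of_real pi * \<i> * of_real x) \<noteq> 0" using pos by auto
  then show "Re (Ln (1 + exp (- of_real pi * \<i> * of_real x))) = ln (2 * cos (pi * x / 2))"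
    using Re_Ln n by metis
qed

text \<open>The term with (x/2)^r is purely imaginary and drops out. The last summand k = r-1 has
  order 1 and yields the logarithm of the cosine.\<close>

lemma Re_log_multicos:
  fixes r :: nat and x :: real
  assumes "\<bar>x\<bar> < 1" "r \<ge> 2"
  defines "A \<equiv> fact (r - 1) / (2 * pi) ^ (r - 1)"
  shows "Re (log_multicos r (of_real x / 2)) =
     (x / 2) ^ (r - 1) * ln (2 * cos (pi * x / 2))
     - A * (\<Sum>k<r-1. (pi * x) ^ k / fact k *
              Re (\<i> ^ k / \<i> ^ (r - 1) * polylog (r - k) (- exp (- of_real pi * \<i> * of_real x))))
     - A * (Re (1 / \<i> ^ (r - 1)) * zetaE r)"
proof -
  define z where "z = - exp (- of_real pi * \<i> * of_real x)"
  have X: "of_real x \<in> slit_half_plane 1" using assms by (simp add: slit_half_plane_def)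
  have c: "fact (r - 1) / (2 * of_real pi * \<i>) ^ (r - 1) = of_real A * (1 / \<i> ^ (r - 1))"
    by (simp add: A_def power_mult_distrib)
  define T where "T k = (pi * x) ^ k / fact k * Re (\<i> ^ k / \<i> ^ (r - 1) * polylog_ext (r - k) z)" for k
  have t: "Re (1 / \<i> ^ (r - 1) * ((of_real pi * \<i>) ^ k / fact k * polylog_ext (r - k) z * of_real x ^ k)) = T k" for k
  proof -
    have "1 / \<i> ^ (r - 1) * ((of_real pi * \<i>) ^ k / fact k * polylog_ext (r - k) z * of_real x ^ k) =
        of_real ((pi * x) ^ k / fact k) * (\<i> ^ k / \<i> ^ (r - 1) * polylog_ext (r - k) z)"
      by (simp add: power_mult_distrib mult_ac)
    moreover have "Re (of_real a * b) = a * Re b" for a b by simp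
    ultimately show ?thesis by (simp only: T_def)
  qed
  have re: "Re (- (of_real A * b) * S + X - of_real A * b * of_real Z) = - A * Re (b * S) + Re X - A * (Re b * Z)"
    for b S X Z by (simp add: algebra_simps)
  have "Re (log_multicos r (of_real x / 2)) =
     - A * Re (1 / \<i> ^ (r - 1) * (\<Sum>k<r. (of_real pi * \<i>) ^ k / fact k * polylog_ext (r - k) z * of_real x ^ k))
     + Re (of_real pi * \<i> / of_nat r * (of_real x / 2) ^ r) - A * (Re (1 / \<i> ^ (r - 1)) * zetaE r)"
    unfolding log_multicos_polylog_ext[OF assms(2) X] c z_def[symmetric]
    by (rule re)
  also have "of_real pi * \<i> / of_nat r * (of_real x / 2) ^ r = of_real (pi / r * (x / 2) ^ r) * \<i>"
    by simp
  also have "Re \<dots> = 0" by (simp only: Re_complex_of_real times_complex.sel) simp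
  also have "Re (1 / \<i> ^ (r - 1) * (\<Sum>k<r. (of_real pi * \<i>) ^ k / fact k * polylog_ext (r - k) z * of_real x ^ k))
       = (\<Sum>k<r. T k)"
    unfolding sum_distrib_left Re_sum t ..
  also have "(\<Sum>k<r. T k) = (\<Sum>k<r-1. T k) + T (r - 1)"
    using assms(2) by (metis Suc_diff_1 sum.lessThan_Suc less_le_trans pos2)
  \<comment> \<open>At k = r-1 the powers of the imaginary unit cancel, leaving the real part of
    -\<open>Ln\<close>.\<close>
  also have "A * T (r - 1) = - ((x / 2) ^ (r - 1) * ln (2 * cos (pi * x / 2)))"
  proof -
    have "r - (r - 1) = 1" using assms(2) by simp
    then have "T (r - 1) = - ((pi * x) ^ (r - 1) / fact (r - 1) * ln (2 * cos (pi * x / 2)))"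
      using Re_Ln_one_plus_exp(2)[OF assms(1)] unfolding T_def z_def polylog_ext_def by simp
    then show ?thesis by (simp add: A_def power_mult_distrib power_divide)
  qed
  then have "- A * ((\<Sum>k<r-1. T k) + T (r - 1)) = (x / 2) ^ (r - 1) * ln (2 * cos (pi * x / 2)) - A * (\<Sum>k<r-1. T k)"
    by (simp add: algebra_simps)
  also have "(\<Sum>k<r-1. T k) = (\<Sum>k<r-1. (pi * x) ^ k / fact k * Re (\<i> ^ k / \<i> ^ (r - 1) * polylog (r - k) z))"
    by (intro sum.cong) (auto simp: T_def polylog_ext_def)
  finally show ?thesis unfolding z_def by simp
qed

lemma imaginary_unit_power_even: "even n \<Longrightarrow> \<i> ^ n = (-1) ^ (n div 2)"
  by (auto elim!: evenE simp: power_mult)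

lemma imaginary_unit_power_odd: "odd n \<Longrightarrow> \<i> ^ n = (-1) ^ ((n - 1) div 2) * \<i>"
  by (auto elim!: oddE simp: power_mult)

text \<open>For even r, 1/i^(r-1) is s i with s = (-1)^(r/2). Odd k thus select real parts, the
  cosine series, and even k imaginary parts, the sine series; the \<open>zetaE\<close> term has real
  part 0.\<close>

lemma Re_log_multicos_even:
  fixes r :: nat and x :: real
  assumes "\<bar>x\<bar> < 1" "r \<ge> 2" "even r"
  shows "Re (log_multicos r (of_real x / 2)) =
     (x / 2) ^ (r - 1) * ln (2 * cos (pi * x / 2)) +
             ( (-1) ^ (r div 2) * fact (r - 1) / (2 * pi) ^ (r - 1) *
               (\<Sum>k\<in>{k. 1 \<le> k \<and> k + 3 \<le> r \<and> odd k}.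
                  (-1) ^ ((k - 1) div 2) * (pi * x) ^ k / fact k *
                  (\<Sum>n. (-1) ^ (n+1) * cos (pi * real (n+1) * x) / real (n+1) ^ (r - k)))
             - (-1) ^ (r div 2) * fact (r - 1) / (2 * pi) ^ (r - 1) *
               (\<Sum>k\<in>{k. k + 2 \<le> r \<and> even k}.
                  (-1) ^ (k div 2) * (pi * x) ^ k / fact k *
                  (\<Sum>n. (-1) ^ (n+1) * sin (pi * real (n+1) * x) / real (n+1) ^ (r - k))))"
proof -
  define z where "z = - exp (- of_real pi * \<i> * of_real x)"
  define s :: real where "s = (-1) ^ (r div 2)"
  define C where "C k = (\<Sum>n. (-1) ^ (n+1) * cos (pi * real (n+1) * x) / real (n+1) ^ (r - k))" for k
  define S where "S k = (\<Sum>n. (-1) ^ (n+1) * sin (pi * real (n+1) * x) / real (n+1) ^ (r - k))" for k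
  define T where "T k = (pi * x) ^ k / fact k * Re (\<i> ^ k / \<i> ^ (r - 1) * polylog (r - k) z)" for k
  have "odd (r - 1)" "(r - 1 - 1) div 2 = r div 2 - 1" "r div 2 \<ge> 1" using assms by auto
  then have "\<i> ^ (r - 1) = (-1) ^ (r div 2 - 1) * \<i>"
    using imaginary_unit_power_odd[of "r - 1"] by metis
  also have "\<dots> = - of_real s * \<i>"
    using \<open>r div 2 \<ge> 1\<close> by (cases "r div 2") (auto simp: s_def)
  finally have inv: "1 / \<i> ^ (r - 1) = of_real s * \<i>"
    by (simp add: s_def field_simps flip: power_add mult_2)
  have T_odd: "T k = - s * ((-1) ^ ((k - 1) div 2) * (pi * x) ^ k / fact k * C k)" if "odd k" "k + 2 \<le> r" for k
  proof -
    have "\<i> ^ k / \<i> ^ (r - 1) = of_real (- (s * (-1) ^ ((k - 1) div 2)))"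
      using inv imaginary_unit_power_odd[OF that(1)] by (simp add: divide_inverse mult_ac)
    moreover have "Re (of_real a * b) = a * Re b" for a b by simp
    moreover have "Re (polylog (r - k) z) = C k"
      using polylog_unit_circle(1)[of "r - k" x] that by (simp add: z_def C_def)
    ultimately show ?thesis unfolding T_def by (simp only:) simp
  qed
  have T_even: "T k = s * ((-1) ^ (k div 2) * (pi * x) ^ k / fact k * S k)" if "even k" "k + 2 \<le> r" for k
  proof -
    have "\<i> ^ k / \<i> ^ (r - 1) = of_real (s * (-1) ^ (k div 2)) * \<i>"
      using inv imaginary_unit_power_even[OF that(1)] by (simp add: divide_inverse mult_ac)
    moreover have "Re (of_real a * \<i> * b) = - (a * Im b)" for a b by simp
    moreover have "Im (polylog (r - k) z) = - S k"
      using polylog_unit_circle(2)[of "r - k" x] that by (simp add: z_def S_def)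
    ultimately show ?thesis unfolding T_def by (simp only:) simp
  qed
  \<comment> \<open>For odd k the bound k + 2 <= r sharpens to k + 3 <= r by parity.\<close>
  have set: "{..<r-1} = {k. 1 \<le> k \<and> k + 3 \<le> r \<and> odd k} \<union> {k. k + 2 \<le> r \<and> even k}" (is "_ = ?O \<union> ?E")
  proof -
    have "k + 3 \<le> r" if "odd k" "k < r - 1" for k
    proof -
      have "k + 2 \<noteq> r" using that assms(3) by auto
      then show ?thesis using that by auto
    qed
    then show ?thesis using assms(2) by (auto simp: odd_pos Suc_leI)
  qed
  have "(\<Sum>k<r-1. T k) = (\<Sum>k\<in>?O. T k) + (\<Sum>k\<in>?E. T k)"
    unfolding set by (rule sum.union_disjoint) (auto intro: finite_subset[of _ "{..r}"])
  also have "(\<Sum>k\<in>?O. T k) = - s * (\<Sum>k\<in>?O. (-1) ^ ((k - 1) div 2) * (pi * x) ^ k / fact k * C k)"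
    unfolding sum_distrib_left by (intro sum.cong refl T_odd) auto
  also have "(\<Sum>k\<in>?E. T k) = s * (\<Sum>k\<in>?E. (-1) ^ (k div 2) * (pi * x) ^ k / fact k * S k)"
    unfolding sum_distrib_left by (intro sum.cong refl T_even) auto
  finally have sum: "(\<Sum>k<r-1. T k) = - s * (\<Sum>k\<in>?O. (-1) ^ ((k - 1) div 2) * (pi * x) ^ k / fact k * C k)
      + s * (\<Sum>k\<in>?E. (-1) ^ (k div 2) * (pi * x) ^ k / fact k * S k)" .
  have "Re (1 / \<i> ^ (r - 1)) = 0" unfolding inv by simp
  then show ?thesis
    unfolding Re_log_multicos[OF assms(1,2)] z_def[symmetric] T_def[symmetric] sum
      C_def[symmetric] S_def[symmetric] s_def[symmetric]
    by (simp add: algebra_simps diff_divide_distrib add_divide_distrib)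
qed

text \<open>For odd r, 1/i^(r-1) is the real sign s, so the roles of even and odd k are exchanged
  and the \<open>zetaE\<close> term survives.\<close>

lemma Re_log_multicos_odd:
  fixes r :: nat and x :: real
  assumes "\<bar>x\<bar> < 1" "r \<ge> 2" "odd r"
  shows "Re (log_multicos r (of_real x / 2)) =
     (x / 2) ^ (r - 1) * ln (2 * cos (pi * x / 2)) +
             ( - ((-1) ^ ((r - 1) div 2)) * fact (r - 1) / (2 * pi) ^ (r - 1) *
               (\<Sum>k\<in>{k. k + 3 \<le> r \<and> even k}.
                  (-1) ^ (k div 2) * (pi * x) ^ k / fact k *
                  (\<Sum>n. (-1) ^ (n+1) * cos (pi * real (n+1) * x) / real (n+1) ^ (r - k)))
             - (-1) ^ ((r - 1) div 2) * fact (r - 1) / (2 * pi) ^ (r - 1) *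
               (\<Sum>k\<in>{k. 1 \<le> k \<and> k + 2 \<le> r \<and> odd k}.
                  (-1) ^ ((k - 1) div 2) * (pi * x) ^ k / fact k *
                  (\<Sum>n. (-1) ^ (n+1) * sin (pi * real (n+1) * x) / real (n+1) ^ (r - k)))
             - (-1) ^ ((r - 1) div 2) * fact (r - 1) / (2 * pi) ^ (r - 1) * zetaE r)"
proof -
  define z where "z = - exp (- of_real pi * \<i> * of_real x)"
  define s :: real where "s = (-1) ^ ((r - 1) div 2)"
  define C where "C k = (\<Sum>n. (-1) ^ (n+1) * cos (pi * real (n+1) * x) / real (n+1) ^ (r - k))" for k
  define S where "S k = (\<Sum>n. (-1) ^ (n+1) * sin (pi * real (n+1) * x) / real (n+1) ^ (r - k))" for k
  define T where "T k = (pi * x) ^ k / fact k * Re (\<i> ^ k / \<i> ^ (r - 1) * polylog (r - k) z)" for k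
  have "even (r - 1)" using assms by auto
  then have "\<i> ^ (r - 1) = of_real s"
    by (simp only: imaginary_unit_power_even s_def) simp
  then have inv: "1 / \<i> ^ (r - 1) = of_real s"
    by (simp add: s_def field_simps flip: power_add mult_2)
  have T_even: "T k = s * ((-1) ^ (k div 2) * (pi * x) ^ k / fact k * C k)" if "even k" "k + 2 \<le> r" for k
  proof -
    have "\<i> ^ k / \<i> ^ (r - 1) = of_real (s * (-1) ^ (k div 2))"
      using inv imaginary_unit_power_even[OF that(1)] by (simp add: divide_inverse mult_ac)
    moreover have "Re (of_real a * b) = a * Re b" for a b by simp
    moreover have "Re (polylog (r - k) z) = C k"
      using polylog_unit_circle(1)[of "r - k" x] that by (simp add: z_def C_def)
    ultimately show ?thesis unfolding T_def by (simp only:) simp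
  qed
  have T_odd: "T k = s * ((-1) ^ ((k - 1) div 2) * (pi * x) ^ k / fact k * S k)" if "odd k" "k + 2 \<le> r" for k
  proof -
    have "\<i> ^ k / \<i> ^ (r - 1) = of_real (s * (-1) ^ ((k - 1) div 2)) * \<i>"
      using inv imaginary_unit_power_odd[OF that(1)] by (simp add: divide_inverse mult_ac)
    moreover have "Re (of_real a * \<i> * b) = - (a * Im b)" for a b by simp
    moreover have "Im (polylog (r - k) z) = - S k"
      using polylog_unit_circle(2)[of "r - k" x] that by (simp add: z_def S_def)
    ultimately show ?thesis unfolding T_def by (simp only:) simp
  qed
  have set: "{..<r-1} = {k. k + 3 \<le> r \<and> even k} \<union> {k. 1 \<le> k \<and> k + 2 \<le> r \<and> odd k}" (is "_ = ?E \<union> ?O")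
  proof -
    have "k + 3 \<le> r" if "even k" "k < r - 1" for k
    proof -
      have "k + 2 \<noteq> r" using that assms(3) by auto
      then show ?thesis using that by auto
    qed
    moreover have "r \<ge> 3" using assms by (cases "r = 2") auto
    ultimately show ?thesis by (auto simp: not_less_eq_eq)
  qed
  have "(\<Sum>k<r-1. T k) = (\<Sum>k\<in>?E. T k) + (\<Sum>k\<in>?O. T k)"
    unfolding set by (rule sum.union_disjoint) (auto intro: finite_subset[of _ "{..r}"])
  also have "(\<Sum>k\<in>?E. T k) = s * (\<Sum>k\<in>?E. (-1) ^ (k div 2) * (pi * x) ^ k / fact k * C k)"
    unfolding sum_distrib_left by (intro sum.cong refl T_even) auto
  also have "(\<Sum>k\<in>?O. T k) = s * (\<Sum>k\<in>?O. (-1) ^ ((k - 1) div 2) * (pi * x) ^ k / fact k * S k)"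
    unfolding sum_distrib_left by (intro sum.cong refl T_odd) auto
  finally have sum: "(\<Sum>k<r-1. T k) = s * (\<Sum>k\<in>?E. (-1) ^ (k div 2) * (pi * x) ^ k / fact k * C k)
      + s * (\<Sum>k\<in>?O. (-1) ^ ((k - 1) div 2) * (pi * x) ^ k / fact k * S k)" .
  have "Re (1 / \<i> ^ (r - 1)) = s" unfolding inv by simp
  then show ?thesis
    unfolding Re_log_multicos[OF assms(1,2)] z_def[symmetric] T_def[symmetric] sum
      C_def[symmetric] S_def[symmetric] s_def[symmetric]
    by (simp add: algebra_simps diff_divide_distrib add_divide_distrib)
qed

text \<open>Positivity of the cosine turns the exponential of a ln(2 cos(pi x/2)) into a real
  power.\<close>

lemma multicos_of_real:
  fixes x B :: real
  assumes "\<bar>x\<bar> < 1" "r \<ge> 2"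
    and "Re (log_multicos r (of_real x / 2)) = a * ln (2 * cos (pi * x / 2)) + B"
  shows "multicos r (of_real x / 2) = of_real ((2 * cos (pi * x / 2)) powr a * exp B)"
proof -
  have "multicos r (of_real x / 2) = exp (of_real (a * ln (2 * cos (pi * x / 2)) + B))"
    unfolding multicos_eq_exp using log_multicos_real[OF assms(1), of r] assms(2,3) by simp
  then show ?thesis
    using Re_Ln_one_plus_exp(1)[OF assms(1)] by (simp add: exp_of_real exp_add powr_def flip: of_real_mult)
qed

theorem theorem2p11:
  fixes r :: nat
  assumes "r \<ge> 2"
  shows
   "(\<forall>x::complex. Im x < 0 \<longrightarrow>
      multicos r (x / 2) = exp (
        - (of_nat (fact (r - 1)) / (2 * of_real pi * \<i>) ^ (r - 1)) *
          (\<Sum>k=0..r-1. (of_real pi * \<i>) ^ k / of_nat (fact k) *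
              polylog (r - k) (- exp (- of_real pi * \<i> * x)) * x ^ k)
        + of_real pi * \<i> / of_nat r * (x / 2) ^ r
        - of_nat (fact (r - 1)) / (2 * of_real pi * \<i>) ^ (r - 1) * of_real (zetaE r)))
  \<and> (\<forall>x::complex. Im x > 0 \<longrightarrow>
      multicos r (x / 2) = exp (
        - (of_nat (fact (r - 1)) / (- 2 * of_real pi * \<i>) ^ (r - 1)) *
          (\<Sum>k=0..r-1. (- of_real pi * \<i>) ^ k / of_nat (fact k) *
              polylog (r - k) (- exp (of_real pi * \<i> * x)) * x ^ k)
        - of_real pi * \<i> / of_nat r * (x / 2) ^ r
        - of_nat (fact (r - 1)) / (- 2 * of_real pi * \<i>) ^ (r - 1) * of_real (zetaE r)))
  \<and> (even r \<longrightarrow> (\<forall>x::real. 0 \<le> x \<and> x < 1 \<longrightarrow>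
      multicos r (of_real x / 2) = of_real (
        (2 * cos (pi * x / 2)) powr ((x / 2) ^ (r - 1)) *
        exp ( (-1) ^ (r div 2) * fact (r - 1) / (2 * pi) ^ (r - 1) *
               (\<Sum>k\<in>{k. 1 \<le> k \<and> k + 3 \<le> r \<and> odd k}.
                  (-1) ^ ((k - 1) div 2) * (pi * x) ^ k / fact k *
                  (\<Sum>n. (-1) ^ (n+1) * cos (pi * real (n+1) * x) / real (n+1) ^ (r - k)))
             - (-1) ^ (r div 2) * fact (r - 1) / (2 * pi) ^ (r - 1) *
               (\<Sum>k\<in>{k. k + 2 \<le> r \<and> even k}.
                  (-1) ^ (k div 2) * (pi * x) ^ k / fact k *
                  (\<Sum>n. (-1) ^ (n+1) * sin (pi * real (n+1) * x) / real (n+1) ^ (r - k)))))))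
  \<and> (odd r \<longrightarrow> (\<forall>x::real. 0 \<le> x \<and> x < 1 \<longrightarrow>
      multicos r (of_real x / 2) = of_real (
        (2 * cos (pi * x / 2)) powr ((x / 2) ^ (r - 1)) *
        exp ( - ((-1) ^ ((r - 1) div 2)) * fact (r - 1) / (2 * pi) ^ (r - 1) *
               (\<Sum>k\<in>{k. k + 3 \<le> r \<and> even k}.
                  (-1) ^ (k div 2) * (pi * x) ^ k / fact k *
                  (\<Sum>n. (-1) ^ (n+1) * cos (pi * real (n+1) * x) / real (n+1) ^ (r - k)))
             - (-1) ^ ((r - 1) div 2) * fact (r - 1) / (2 * pi) ^ (r - 1) *
               (\<Sum>k\<in>{k. 1 \<le> k \<and> k + 2 \<le> r \<and> odd k}.
                  (-1) ^ ((k - 1) div 2) * (pi * x) ^ k / fact k *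
                  (\<Sum>n. (-1) ^ (n+1) * sin (pi * real (n+1) * x) / real (n+1) ^ (r - k)))
             - (-1) ^ ((r - 1) div 2) * fact (r - 1) / (2 * pi) ^ (r - 1) * zetaE r))))"
proof (intro conjI allI impI)
  fix x :: complex
  assume "Im x < 0"
  then show "multicos r (x / 2) = exp (
        - (of_nat (fact (r - 1)) / (2 * of_real pi * \<i>) ^ (r - 1)) *
          (\<Sum>k=0..r-1. (of_real pi * \<i>) ^ k / of_nat (fact k) *
              polylog (r - k) (- exp (- of_real pi * \<i> * x)) * x ^ k)
        + of_real pi * \<i> / of_nat r * (x / 2) ^ r
        - of_nat (fact (r - 1)) / (2 * of_real pi * \<i>) ^ (r - 1) * of_real (zetaE r))"
    unfolding multicos_eq_exp by (intro arg_cong[of _ _ exp] log_multicos_lower assms)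
next
  fix x :: complex
  assume "Im x > 0"
  then show "multicos r (x / 2) = exp (
        - (of_nat (fact (r - 1)) / (- 2 * of_real pi * \<i>) ^ (r - 1)) *
          (\<Sum>k=0..r-1. (- of_real pi * \<i>) ^ k / of_nat (fact k) *
              polylog (r - k) (- exp (of_real pi * \<i> * x)) * x ^ k)
        - of_real pi * \<i> / of_nat r * (x / 2) ^ r
        - of_nat (fact (r - 1)) / (- 2 * of_real pi * \<i>) ^ (r - 1) * of_real (zetaE r))"
    unfolding multicos_eq_exp by (intro arg_cong[of _ _ exp] log_multicos_upper assms)
qed ((rule multicos_of_real[OF _ _ Re_log_multicos_even]; use assms in force),
     (rule multicos_of_real[OF _ _ Re_log_multicos_odd]; use assms in force))

end
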